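(* Assume the setting and Hypotheses (A), (B), (C) described in the context. For $\theta\in\Theta$ and $\theta'\in\Theta$ belonging to the local stable fibre of $\theta$, and $n\in\mathbb{N}$, let $$G_{\theta,\theta',n}: K_n(\theta)\to K_n(\theta'),\qquad y\mapsto f^n_{S^{-n}\theta'}\circ (f^n_{S^{-n}\theta})^{-1}(y).$$ Then the limit $$G_{\theta,\theta'}:=\lim_{n\to\infty}G_{\theta,\theta',n}$$ exists uniformly on $K(\theta)$. Moreover, $G_{\theta,\theta'}(K(\theta))=K(\theta')$, and there is a continuous function $H_{\theta,\theta'}:K(\theta)\to\mathbb{R}$ such that $\lim_{n\to\infty}G'_{\theta,\theta',n}=H_{\theta,\theta'}$ uniformly on $K(\theta)$, $G'_{\theta,\theta'}=H_{\theta,\theta'}$ on the interior of $K(\theta)$, and (when $K(\theta)$ is nondegenerate) this equality extends to the one-sided derivatives of $G_{\theta,\theta'}$ at the endpoints of $K(\theta)$. In this sense, $G_{\theta,\theta'}:K(\theta)\to K(\theta')$ is an orientation preserving diffeomorphism whenever $\theta\notin P$.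
   Context: Setting. $(\Theta,d)$ is a compact metric space, $S:\Theta\to\Theta$ is a Borel measurable invertible map, $\mathbb{I}=[-M,M]$ is a compact interval, and $F(\theta,y)=(S\theta,f_\theta(y))$ is a skew product on $\Theta\times\mathbb{I}$ whose fibre maps $f_\theta:\mathbb{I}\to(-M,M)$ are uniformly bounded increasing $C^3$ maps with $\inf_{(\theta,y)}f_\theta'(y)>0$ and $\sup_{(\theta,y)}\mathcal{S}f_\theta(y)<0$, where primes denote derivatives in $y$ and $\mathcal{S}f_\theta=\frac{f_\theta'''}{f_\theta'}-\frac32\big(\frac{f_\theta''}{f_\theta'}\big)^2$. Write $f_\theta^n=f_{S^{n-1}\theta}\circ\cdots\circ f_\theta$ (a map on $\mathbb{I}$), and $(f^n_\theta)^{-1}$ for its inverse, defined on $f^n_\theta(\mathbb{I})$. Bounding graphs. $\phi_n^{\pm}(\theta):=f^n_{S^{-n}\theta}(\pm M)$ and $\phi^{\pm}(\theta):=\lim_{n\to\infty}\phi_n^{\pm}(\theta)$ (monotone limits: $\phi_n^-\nearrow\phi^-$, $\phi_n^+\searrow\phi^+$). $K_n(\theta):=[\phi_n^-(\theta),\phi_n^+(\theta)]$, $K(\theta):=[\phi^-(\theta),\phi^+(\theta)]$. The set of pinch points is $P:=\{\theta\in\Theta:\phi^+(\theta)=\phi^-(\theta)\}$. Hypothesis (A): there is $L$ such that for all $\theta,\theta'\in\Theta$, $\sup_{y\in\mathbb{I}}|f_\theta(y)-f_{\theta'}(y)|+\sup_{y\in\mathbb{I}}|f'_\theta(y)-f'_{\theta'}(y)|\le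 L\,d(\theta,\theta')$. Hypothesis (B): there is a piecewise expanding and piecewise $C^{1+}$ (i.e. $C^1$ with Hölder continuous derivative) mixing Markov map $\hat S:\mathbb{T}^1\to\mathbb{T}^1$ with finitely many branches, and a measurable $\Pi:\Theta\to\mathbb{T}^1$ with $\hat S\circ\Pi=\Pi\circ S^{-1}$; there is an injection $\sigma:\mathbb{T}^1\to\Theta$, Hölder continuous on monotonicity intervals of $\hat S$, with $\Pi\circ\sigma=\mathrm{id}_{\mathbb{T}^1}$; and there are $C>0$, $\alpha\in(0,1)$ such that for all $\theta\in\Theta$ and $n>0$, $d(S^{-n}\theta,S^{-n}(\sigma\Pi\theta))\le C\alpha^n d(\theta,\sigma\Pi\theta)$. Hypothesis (C): with $Q_f:=\sup_{(\theta,y)}f'_\theta(y)$ and $Q'_f:=\sup_{(\theta,y)}|(\log f'_\theta(y))'|$, one has $\alpha Q_f<1$ and $Q'_f<\infty$. A point $\theta'$ is said to belong to the local stable fibre of $\theta$ (with respect to $S^{-1}$) if $d(S^{-n}\theta,S^{-n}\theta')\le C\alpha^n d(\theta,\theta')$ for all $n>0$, with the constants $C,\alpha$ of Hypothesis (B). *)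

theory Defs
  imports "HOL-Analysis.Analysis"
begin

section \<open>Derivatives on intervals and Hoelder maps\<close>

text \<open>
  The derivative relative to a set, so that it is one-sided at the endpoints of a
  compact interval.  It is meaningful only where the function is differentiable
  within that set and the point is an accumulation point of it.
\<close>
definition deriv_on :: "real set \<Rightarrow> (real \<Rightarrow> real) \<Rightarrow> real \<Rightarrow> real" where
  "deriv_on A g y = vector_derivative g (at y within A)"

primrec Ck_on :: "nat \<Rightarrow> real set \<Rightarrow> (real \<Rightarrow> real) \<Rightarrow> bool" where
  "Ck_on 0 A g \<longleftrightarrow> continuous_on A g"
| "Ck_on (Suc k) A g \<longleftrightarrow> g differentiable_on A \<and> Ck_on k A (deriv_on A g)"

definition schwarzian_on :: "real set \<Rightarrow> (real \<Rightarrow> real) \<Rightarrow> real \<Rightarrow> real" where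
  "schwarzian_on A g y =
     (let g1 = deriv_on A g; g2 = deriv_on A g1; g3 = deriv_on A g2
      in g3 y / g1 y - 3 / 2 * (g2 y / g1 y)\<^sup>2)"

definition orientation_preserving_diffeo_on ::
    "real set \<Rightarrow> real set \<Rightarrow> (real \<Rightarrow> real) \<Rightarrow> bool" where
  "orientation_preserving_diffeo_on A B g \<longleftrightarrow>
     bij_betw g A B \<and> strict_mono_on A g \<and> Ck_on 1 A g \<and> Ck_on 1 B (inv_into A g)"

definition holder_on :: "'a::metric_space set \<Rightarrow> ('a \<Rightarrow> 'b::metric_space) \<Rightarrow> bool" where
  "holder_on X g \<longleftrightarrow>
     (\<exists>c \<beta>. 0 < \<beta> \<and> \<beta> \<le> 1 \<and> (\<forall>x\<in>X. \<forall>y\<in>X. dist (g x) (g y) \<le> c * dist x y powr \<beta>))"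


section \<open>The skew product\<close>

text \<open>
  The fibre maps are total functions on the reals, of which only the restriction to
  \<open>{-M..M}\<close> is ever used.  Suprema and infima are taken in the extended reals, since
  a supremum of an unbounded set is unspecified in the reals.
\<close>
definition skew_setting :: "('a::metric_space \<Rightarrow> 'a) \<Rightarrow> real \<Rightarrow> ('a \<Rightarrow> real \<Rightarrow> real) \<Rightarrow> bool" where
  "skew_setting S M f \<longleftrightarrow>
     compact (UNIV :: 'a set) \<and> S \<in> borel_measurable borel \<and> bij S \<and> 0 < M \<and>
     (\<forall>\<theta>. f \<theta> ` {-M..M} \<subseteq> {-M<..<M} \<and> strict_mono_on {-M..M} (f \<theta>) \<and> Ck_on 3 {-M..M} (f \<theta>)) \<and>
     (INF (\<theta>, y) \<in> UNIV \<times> {-M..M}. ereal (deriv_on {-M..M} (f \<theta>) y)) > 0 \<and>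
     (SUP (\<theta>, y) \<in> UNIV \<times> {-M..M}. ereal (schwarzian_on {-M..M} (f \<theta>) y)) < 0"

primrec fiter :: "('a \<Rightarrow> 'a) \<Rightarrow> ('a \<Rightarrow> real \<Rightarrow> real) \<Rightarrow> 'a \<Rightarrow> nat \<Rightarrow> real \<Rightarrow> real" where
  "fiter S f \<theta> 0 y = y"
| "fiter S f \<theta> (Suc n) y = f ((S ^^ n) \<theta>) (fiter S f \<theta> n y)"

definition backward :: "('a \<Rightarrow> 'a) \<Rightarrow> nat \<Rightarrow> 'a \<Rightarrow> 'a" where
  "backward S n = inv S ^^ n"


section \<open>Bounding graphs\<close>

definition phi_minus_n :: "('a \<Rightarrow> 'a) \<Rightarrow> real \<Rightarrow> ('a \<Rightarrow> real \<Rightarrow> real) \<Rightarrow> nat \<Rightarrow> 'a \<Rightarrow> real" where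
  "phi_minus_n S M f n \<theta> = fiter S f (backward S n \<theta>) n (- M)"

definition phi_plus_n :: "('a \<Rightarrow> 'a) \<Rightarrow> real \<Rightarrow> ('a \<Rightarrow> real \<Rightarrow> real) \<Rightarrow> nat \<Rightarrow> 'a \<Rightarrow> real" where
  "phi_plus_n S M f n \<theta> = fiter S f (backward S n \<theta>) n M"

definition phi_minus :: "('a \<Rightarrow> 'a) \<Rightarrow> real \<Rightarrow> ('a \<Rightarrow> real \<Rightarrow> real) \<Rightarrow> 'a \<Rightarrow> real" where
  "phi_minus S M f \<theta> = lim (\<lambda>n. phi_minus_n S M f n \<theta>)"

definition phi_plus :: "('a \<Rightarrow> 'a) \<Rightarrow> real \<Rightarrow> ('a \<Rightarrow> real \<Rightarrow> real) \<Rightarrow> 'a \<Rightarrow> real" where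
  "phi_plus S M f \<theta> = lim (\<lambda>n. phi_plus_n S M f n \<theta>)"

definition K_n :: "('a \<Rightarrow> 'a) \<Rightarrow> real \<Rightarrow> ('a \<Rightarrow> real \<Rightarrow> real) \<Rightarrow> nat \<Rightarrow> 'a \<Rightarrow> real set" where
  "K_n S M f n \<theta> = {phi_minus_n S M f n \<theta>..phi_plus_n S M f n \<theta>}"

definition K_lim :: "('a \<Rightarrow> 'a) \<Rightarrow> real \<Rightarrow> ('a \<Rightarrow> real \<Rightarrow> real) \<Rightarrow> 'a \<Rightarrow> real set" where
  "K_lim S M f \<theta> = {phi_minus S M f \<theta>..phi_plus S M f \<theta>}"

definition pinch_points :: "('a \<Rightarrow> 'a) \<Rightarrow> real \<Rightarrow> ('a \<Rightarrow> real \<Rightarrow> real) \<Rightarrow> 'a set" where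
  "pinch_points S M f = {\<theta>. phi_plus S M f \<theta> = phi_minus S M f \<theta>}"


section \<open>Expanding Markov maps of the circle\<close>

text \<open>
  The circle is the unit circle of the complex plane, with \<open>t\<close> in \<open>\<real>/\<int>\<close> corresponding
  to \<open>circ_pt t\<close>.  Smoothness of a circle map on an arc is smoothness of a lift.
\<close>
abbreviation circle :: "complex set" where
  "circle \<equiv> sphere 0 1"

definition circ_pt :: "real \<Rightarrow> complex" where
  "circ_pt t = cis (2 * pi * t)"

definition arc_between :: "real \<Rightarrow> real \<Rightarrow> complex set" where
  "arc_between s t = circ_pt ` {s<..<t}"

text \<open>
  The circle is cut at the points \<open>circ_pt (a 0), \<dots>, circ_pt (a (k - 1))\<close> into \<open>k\<close> open
  arcs, the monotonicity intervals.  Nothing is required of \<open>T\<close> at the cut points.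
  The Hoelder condition on \<open>deriv g\<close> contains its continuity.
\<close>
definition expanding_markov_partition ::
    "(complex \<Rightarrow> complex) \<Rightarrow> nat \<Rightarrow> (nat \<Rightarrow> real) \<Rightarrow> bool" where
  "expanding_markov_partition T k a \<longleftrightarrow>
     0 < k \<and> (\<forall>i<k. a i < a (Suc i)) \<and> a k = a 0 + 1 \<and>
     (\<exists>l>1. \<forall>i<k. \<exists>g.
        (\<forall>t\<in>{a i<..<a (Suc i)}. T (circ_pt t) = circ_pt (g t)) \<and>
        g differentiable_on {a i<..<a (Suc i)} \<and>
        holder_on {a i<..<a (Suc i)} (deriv g) \<and>
        (\<forall>t\<in>{a i<..<a (Suc i)}. l \<le> \<bar>deriv g t\<bar>)) \<and>
     (\<forall>i<k. inj_on T (arc_between (a i) (a (Suc i)))) \<and>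
     (\<forall>i<k. \<forall>j<k.
        T ` arc_between (a i) (a (Suc i)) \<inter> arc_between (a j) (a (Suc j)) \<noteq> {} \<longrightarrow>
        arc_between (a j) (a (Suc j)) \<subseteq> T ` arc_between (a i) (a (Suc i)))"

definition topologically_mixing_on :: "'a::topological_space set \<Rightarrow> ('a \<Rightarrow> 'a) \<Rightarrow> bool" where
  "topologically_mixing_on X T \<longleftrightarrow>
     (\<forall>U V. openin (top_of_set X) U \<and> openin (top_of_set X) V \<and> U \<noteq> {} \<and> V \<noteq> {} \<longrightarrow>
        (\<exists>N. \<forall>n\<ge>N. (T ^^ n) ` U \<inter> V \<noteq> {}))"


section \<open>The hypotheses\<close>

definition hypothesis_A :: "real \<Rightarrow> ('a::metric_space \<Rightarrow> real \<Rightarrow> real) \<Rightarrow> bool" where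
  "hypothesis_A M f \<longleftrightarrow>
     (\<exists>L::real. \<forall>\<theta> \<theta>'.
        (SUP y\<in>{-M..M}. ereal \<bar>f \<theta> y - f \<theta>' y\<bar>) +
        (SUP y\<in>{-M..M}. ereal \<bar>deriv_on {-M..M} (f \<theta>) y - deriv_on {-M..M} (f \<theta>') y\<bar>)
        \<le> ereal (L * dist \<theta> \<theta>'))"

definition in_local_stable_fibre ::
    "('a::metric_space \<Rightarrow> 'a) \<Rightarrow> real \<Rightarrow> real \<Rightarrow> 'a \<Rightarrow> 'a \<Rightarrow> bool" where
  "in_local_stable_fibre S C \<alpha> \<theta> \<theta>' \<longleftrightarrow>
     (\<forall>n>0. dist (backward S n \<theta>) (backward S n \<theta>') \<le> C * \<alpha> ^ n * dist \<theta> \<theta>')"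

definition hypothesis_B ::
    "('a::metric_space \<Rightarrow> 'a) \<Rightarrow> (complex \<Rightarrow> complex) \<Rightarrow> ('a \<Rightarrow> complex) \<Rightarrow> (complex \<Rightarrow> 'a) \<Rightarrow>
     real \<Rightarrow> real \<Rightarrow> bool" where
  "hypothesis_B S T p \<sigma> C \<alpha> \<longleftrightarrow>
     T ` circle \<subseteq> circle \<and>
     (\<exists>k a. expanding_markov_partition T k a \<and>
        (\<forall>i<k. holder_on (arc_between (a i) (a (Suc i))) \<sigma>)) \<and>
     topologically_mixing_on circle T \<and>
     p \<in> measurable borel (restrict_space borel circle) \<and>
     (\<forall>\<theta>. T (p \<theta>) = p (inv S \<theta>)) \<and>
     inj_on \<sigma> circle \<and>
     (\<forall>x\<in>circle. p (\<sigma> x) = x) \<and>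
     0 < C \<and> 0 < \<alpha> \<and> \<alpha> < 1 \<and>
     (\<forall>\<theta>. in_local_stable_fibre S C \<alpha> \<theta> (\<sigma> (p \<theta>)))"

definition Q_f :: "real \<Rightarrow> ('a \<Rightarrow> real \<Rightarrow> real) \<Rightarrow> ereal" where
  "Q_f M f = (SUP (\<theta>, y) \<in> UNIV \<times> {-M..M}. ereal (deriv_on {-M..M} (f \<theta>) y))"

definition Q'_f :: "real \<Rightarrow> ('a \<Rightarrow> real \<Rightarrow> real) \<Rightarrow> ereal" where
  "Q'_f M f = (SUP (\<theta>, y) \<in> UNIV \<times> {-M..M}.
     ereal \<bar>deriv_on {-M..M} (\<lambda>z. ln (deriv_on {-M..M} (f \<theta>) z)) y\<bar>)"

definition hypothesis_C :: "real \<Rightarrow> ('a \<Rightarrow> real \<Rightarrow> real) \<Rightarrow> real \<Rightarrow> bool" where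
  "hypothesis_C M f \<alpha> \<longleftrightarrow> ereal \<alpha> * Q_f M f < 1 \<and> Q'_f M f < \<infinity>"


section \<open>The holonomies\<close>

definition G_n ::
    "('a \<Rightarrow> 'a) \<Rightarrow> real \<Rightarrow> ('a \<Rightarrow> real \<Rightarrow> real) \<Rightarrow> 'a \<Rightarrow> 'a \<Rightarrow> nat \<Rightarrow> real \<Rightarrow> real" where
  "G_n S M f \<theta> \<theta>' n y =
     fiter S f (backward S n \<theta>') n (inv_into {-M..M} (fiter S f (backward S n \<theta>) n) y)"

definition G_lim ::
    "('a \<Rightarrow> 'a) \<Rightarrow> real \<Rightarrow> ('a \<Rightarrow> real \<Rightarrow> real) \<Rightarrow> 'a \<Rightarrow> 'a \<Rightarrow> real \<Rightarrow> real" where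
  "G_lim S M f \<theta> \<theta>' y = lim (\<lambda>n. G_n S M f \<theta> \<theta>' n y)"

end

theory Submission
  imports Defs
begin

text \<open>
  Number the fibre maps backwards along the orbits: \<open>a k\<close> is the fibre map over
  \<open>S\<^bsup>-(k+1)\<^esup> \<theta>\<close> and \<open>b k\<close> the one over \<open>S\<^bsup>-(k+1)\<^esup> \<theta>'\<close>.  The iterates that end in the fibres
  over \<open>\<theta>\<close> and \<open>\<theta>'\<close> are then \<open>A n = a 0 \<circ> \<dots> \<circ> a (n - 1)\<close> and
  \<open>B n = b 0 \<circ> \<dots> \<circ> b (n - 1)\<close>; passing from \<open>n\<close> to \<open>n + 1\<close> adds a map on the inside, and
  the holonomy is \<open>B n\<close> after the inverse of \<open>A n\<close>.  On a local stable fibre the maps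
  \<open>a k\<close> and \<open>b k\<close> differ by \<open>O(\<alpha>\<^sup>k)\<close> together with their derivatives, while one fibre map
  expands by at most a factor \<open>Q\<close> with \<open>\<alpha> Q < 1\<close>.  This competition decides everything.

  Write a point \<open>y\<close> of \<open>K(\<theta>)\<close> as \<open>A n x\<^sub>n\<close> with \<open>x\<^sub>n = a n x\<^sub>n\<^sub>+\<^sub>1\<close>.  Then the holonomies of
  orders \<open>n + 1\<close> and \<open>n\<close> take at \<open>y\<close> the values of \<open>B n\<close> at \<open>b n x\<^sub>n\<^sub>+\<^sub>1\<close> and
  \<open>a n x\<^sub>n\<^sub>+\<^sub>1\<close>.  These arguments are \<open>O(\<alpha>\<^sup>n)\<close> apart and \<open>B n\<close> is \<open>Q\<^sup>n\<close>-Lipschitz, so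
  the increments are \<open>O((\<alpha> Q)\<^sup>n)\<close> and the convergence is uniform
  (\<open>hol_step\<close>, \<open>hol_uniform_limit\<close>).

  The logarithm of the derivative is, by the chain rule, a sum over the levels \<open>i < n\<close> of
  differences of \<open>ln b'\<^sub>i\<close> and \<open>ln a'\<^sub>i\<close> at corresponding points of the two orbits.  The
  orbits are \<open>O(\<alpha>\<^sup>i)\<close> close at level \<open>i\<close> (\<open>seg_close\<close>), and \<open>ln b'\<^sub>i\<close> is Lipschitz, so
  the sum is bounded uniformly in \<open>n\<close> (\<open>log_deriv_bound\<close>).  When \<open>n\<close> grows to \<open>n + 1\<close> the
  \<open>a\<close>-orbit stays the same and the \<open>b\<close>-orbit moves at level \<open>i\<close> by
  \<open>O(Q\<^bsup>n-i\<^esup> \<alpha>\<^sup>n)\<close>; summed over \<open>i\<close> this is again \<open>O((\<alpha> Q)\<^sup>n)\<close>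
  (\<open>log_deriv_step\<close>).  Hence the derivatives converge uniformly to a positive continuous
  function, which is the derivative of the limit.

  The uniform bound on the logarithmic derivatives holds on all of \<open>K\<^sub>n(\<theta>)\<close>, so the
  holonomies are uniformly bi-Lipschitz there.  It follows that the limit is strictly increasing,
  and also that it maps endpoints to endpoints: the endpoints of \<open>K\<^sub>n(\<theta>)\<close> go exactly to
  those of \<open>K\<^sub>n(\<theta>')\<close>, and they converge to the endpoints of \<open>K(\<theta>)\<close> and \<open>K(\<theta>')\<close>
  (\<open>hol_tendsto_moving_point\<close>).
\<close>

section \<open>Calculus on compact intervals\<close>

lemma increment_bounds:
  fixes g g' :: "real \<Rightarrow> real"
  assumes deriv: "\<And>t. t \<in> {l..u} \<Longrightarrow> (g has_real_derivative g' t) (at t within {l..u})"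
    and bounds: "\<And>t. t \<in> {l..u} \<Longrightarrow> m \<le> g' t \<and> g' t \<le> B"
    and xy: "l \<le> x" "x \<le> y" "y \<le> u"
  shows "m * (y - x) \<le> g y - g x" and "g y - g x \<le> B * (y - x)"
proof -
  have "\<exists>t\<in>{x..y}. g y - g x = g' t * (y - x)"
  proof (rule mvt_very_simple[OF xy(2)])
    fix t assume "x \<le> t" "t \<le> y"
    then have "(g has_real_derivative g' t) (at t within {x..y})"
      using xy by (intro DERIV_subset[OF deriv]) auto
    then show "(g has_derivative (*) (g' t)) (at t within {x..y})"
      by (rule has_field_derivative_imp_has_derivative)
  qed
  then obtain t where "t \<in> {x..y}" and t: "g y - g x = g' t * (y - x)"
    by blast
  then have "m \<le> g' t \<and> g' t \<le> B"
    using xy by (intro bounds) auto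
  then show "m * (y - x) \<le> g y - g x" "g y - g x \<le> B * (y - x)"
    unfolding t using xy by (auto intro!: mult_right_mono)
qed

lemma deriv_on_eqI:
  assumes "l < u" "t \<in> {l..u}" "(g has_real_derivative D) (at t within {l..u})"
  shows "deriv_on {l..u} g t = D"
  unfolding deriv_on_def
  using assms by (intro vector_derivative_within_closed_interval)
    (auto simp: has_real_derivative_iff_has_vector_derivative)

lemma has_real_derivative_deriv_on:
  assumes "g differentiable_on A" "t \<in> A"
  shows "(g has_real_derivative deriv_on A g t) (at t within A)"
  using assms unfolding deriv_on_def differentiable_on_def
  by (simp add: has_real_derivative_iff_has_vector_derivative vector_derivative_works[symmetric])

text \<open>
  The derivatives are relative to \<open>A\<close> and its image, so that endpoints of intervals are
  covered; continuity of the inverse comes from compactness.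
\<close>
lemma has_real_derivative_inv_into:
  fixes g :: "real \<Rightarrow> real"
  assumes "compact A" "inj_on g A" "continuous_on A g"
    and "x \<in> A" "(g has_real_derivative D) (at x within A)" "D \<noteq> 0"
  shows "(inv_into A g has_real_derivative inverse D) (at (g x) within g ` A)"
proof -
  have "continuous_on (g ` A) (inv_into A g)"
    using assms by (intro continuous_on_inv) auto
  then show ?thesis
    unfolding has_field_derivative_def
    using assms
    by (intro has_derivative_inverse_within[where f' = "(*) D"])
      (auto simp: has_field_derivative_def continuous_on_eq_continuous_within
        linear_times fun_eq_iff)
qed

lemma abs_ln_diff_le:
  fixes c s t :: real
  assumes "0 < c" "c \<le> s" "c \<le> t"
  shows "\<bar>ln s - ln t\<bar> \<le> \<bar>s - t\<bar> / c"
proof -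
  have one_sided: "ln v - ln w \<le> \<bar>v - w\<bar> / c" if "c \<le> v" "c \<le> w" for v w
  proof -
    have "ln v - ln w \<le> (v - w) / w"
      using that assms(1) by (intro ln_diff_le) auto
    also have "\<dots> \<le> \<bar>v - w\<bar> / c"
      using that assms(1) by (intro frac_le) auto
    finally show ?thesis .
  qed
  show ?thesis
    using one_sided[of s t] one_sided[of t s] assms by (auto simp: abs_minus_commute)
qed

lemma uniform_limit_lim_of_geometric_increments:
  fixes v :: "nat \<Rightarrow> 'b \<Rightarrow> real"
  assumes "\<And>n y. y \<in> X \<Longrightarrow> \<bar>v (Suc n) y - v n y\<bar> \<le> B * r ^ n"
    and "0 \<le> r" "r < 1"
  shows "uniform_limit X v (\<lambda>y. lim (\<lambda>n. v n y)) sequentially"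
proof -
  have "summable (\<lambda>n. B * r ^ n)"
    using assms by (intro summable_mult summable_geometric) auto
  then have "uniform_limit X (\<lambda>n y. \<Sum>i<n. v (Suc i) y - v i y)
      (\<lambda>y. \<Sum>i. v (Suc i) y - v i y) sequentially"
    using assms by (intro Weierstrass_m_test) auto
  then have "uniform_limit X (\<lambda>n y. v 0 y + (\<Sum>i<n. v (Suc i) y - v i y))
      (\<lambda>y. v 0 y + (\<Sum>i. v (Suc i) y - v i y)) sequentially"
    by (intro uniform_limit_intros)
  then have ul: "uniform_limit X v (\<lambda>y. v 0 y + (\<Sum>i. v (Suc i) y - v i y)) sequentially"
    by (simp add: sum_lessThan_telescope[where f = "\<lambda>n. v n y" for y])
  show ?thesis
  proof (rule uniform_limit_cong'[THEN iffD1, OF _ _ ul])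
    fix y assume "y \<in> X"
    then show "v 0 y + (\<Sum>i. v (Suc i) y - v i y) = lim (\<lambda>n. v n y)"
      using tendsto_uniform_limitI[OF ul] by (metis limI)
  qed auto
qed


section \<open>Compositions along a sequence of interval maps\<close>

text \<open>
  \<open>seg a k n\<close> is \<open>a k \<circ> \<dots> \<circ> a (n - 1)\<close>.  Both ends are kept as parameters because
  induction on \<open>n\<close> peels off the innermost map and induction on \<open>k\<close> the outermost one,
  and the estimates below need both.
\<close>
definition seg :: "(nat \<Rightarrow> 'b \<Rightarrow> 'b) \<Rightarrow> nat \<Rightarrow> nat \<Rightarrow> 'b \<Rightarrow> 'b" where
  "seg a k n x = foldr a [k..<n] x"

lemma seg_same [simp]: "seg a n n x = x"
  by (simp add: seg_def)

lemma seg_Suc_right: "k \<le> n \<Longrightarrow> seg a k (Suc n) x = seg a k n (a n x)"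
  by (simp add: seg_def)

lemma seg_left: "k < n \<Longrightarrow> seg a k n x = a k (seg a (Suc k) n x)"
  by (simp add: seg_def upt_rec[of k n])

text \<open>
  The maps along one backward orbit.  The bound \<open>distortion\<close> is the only trace of second
  derivatives: in the application \<open>K\<close> bounds the derivative of \<open>ln (a' n)\<close>.
\<close>
locale interval_map_sequence =
  fixes M c Q K :: real and a a' :: "nat \<Rightarrow> real \<Rightarrow> real"
  assumes M_pos: "0 < M" and c_pos: "0 < c"
    and maps: "x \<in> {-M..M} \<Longrightarrow> a n x \<in> {-M..M}"
    and deriv: "x \<in> {-M..M} \<Longrightarrow> (a n has_real_derivative a' n x) (at x within {-M..M})"
    and deriv_lower: "x \<in> {-M..M} \<Longrightarrow> c \<le> a' n x"
    and deriv_upper: "x \<in> {-M..M} \<Longrightarrow> a' n x \<le> Q"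
    and deriv_continuous: "continuous_on {-M..M} (a' n)"
    and distortion: "x \<in> {-M..M} \<Longrightarrow> y \<in> {-M..M} \<Longrightarrow>
          \<bar>ln (a' n x) - ln (a' n y)\<bar> \<le> K * \<bar>x - y\<bar>"
begin

text \<open>
  The chain-rule expression for the derivative of \<open>seg a 0 n\<close>: the factor of level \<open>i\<close> is
  evaluated where the inner maps with indices \<open>i + 1, \<dots>, n - 1\<close> have brought \<open>x\<close>.
\<close>
definition seg' :: "nat \<Rightarrow> real \<Rightarrow> real" where
  "seg' n x = (\<Prod>i<n. a' i (seg a (Suc i) n x))"

definition low :: "nat \<Rightarrow> real" where "low n = seg a 0 n (- M)"
definition high :: "nat \<Rightarrow> real" where "high n = seg a 0 n M"

text \<open>
  The endpoints are monotone in \<open>n\<close>, so this is the intersection of the nested images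
  of \<open>{-M..M}\<close> under \<open>seg a 0 n\<close>.
\<close>
definition core :: "real set" where "core = {lim low..lim high}"

abbreviation pull :: "nat \<Rightarrow> real \<Rightarrow> real" where
  "pull n \<equiv> inv_into {-M..M} (seg a 0 n)"

lemma deriv_pos: "x \<in> {-M..M} \<Longrightarrow> 0 < a' n x"
  using deriv_lower[of x n] c_pos by auto

lemma step_lipschitz:
  assumes "x \<in> {-M..M}" "y \<in> {-M..M}"
  shows "\<bar>a n x - a n y\<bar> \<le> Q * \<bar>x - y\<bar>"
proof -
  have "norm (a n x - a n y) \<le> Q * norm (x - y)"
  proof (rule field_differentiable_bound[OF _ deriv _ assms])
    fix z assume "z \<in> {-M..M}"
    then show "norm (a' n z) \<le> Q"
      using deriv_pos[of z n] deriv_upper[of z n] by auto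
  qed auto
  then show ?thesis by simp
qed

lemma seg_in:
  assumes "k \<le> n" "x \<in> {-M..M}" shows "seg a k n x \<in> {-M..M}"
  using assms
proof (induction n arbitrary: x rule: dec_induct)
  case (step n)
  then show ?case
    using maps by (simp only: seg_Suc_right)
qed simp

lemma seg_lipschitz:
  assumes "0 \<le> Q" "k \<le> n" "x \<in> {-M..M}" "y \<in> {-M..M}"
  shows "\<bar>seg a k n x - seg a k n y\<bar> \<le> Q ^ (n - k) * \<bar>x - y\<bar>"
  using assms(2-)
proof (induction n arbitrary: x y rule: dec_induct)
  case (step n)
  have "\<bar>seg a k (Suc n) x - seg a k (Suc n) y\<bar> \<le> Q ^ (n - k) * \<bar>a n x - a n y\<bar>"
    using step.IH[OF maps[OF step.prems(1)] maps[OF step.prems(2)]] step.hyps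
    by (simp add: seg_Suc_right)
  also have "\<dots> \<le> Q ^ (n - k) * (Q * \<bar>x - y\<bar>)"
    using assms(1) step.prems by (intro mult_left_mono step_lipschitz) auto
  also have "\<dots> = Q ^ (Suc n - k) * \<bar>x - y\<bar>"
    using step.hyps by (simp add: Suc_diff_le)
  finally show ?case .
qed simp

lemma seg_deriv:
  "x \<in> {-M..M} \<Longrightarrow> (seg a 0 n has_real_derivative seg' n x) (at x within {-M..M})"
proof (induction n arbitrary: x)
  case 0
  then show ?case
    by (simp add: seg'_def)
next
  case (Suc n)
  have "(seg a 0 n has_real_derivative seg' n (a n x)) (at (a n x) within a n ` {-M..M})"
    using maps by (intro DERIV_subset[OF Suc.IH[OF maps[OF Suc.prems]]]) blast
  then have "(seg a 0 n \<circ> a n has_real_derivative seg' n (a n x) * a' n x) (at x within {-M..M})"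
    by (intro DERIV_image_chain deriv Suc.prems)
  moreover have "seg a 0 n \<circ> a n = seg a 0 (Suc n)"
    by (simp add: fun_eq_iff seg_Suc_right)
  moreover have "seg' n (a n x) * a' n x = seg' (Suc n) x"
    by (simp add: seg'_def seg_Suc_right)
  ultimately show ?case by simp
qed

lemma seg'_pos: "x \<in> {-M..M} \<Longrightarrow> 0 < seg' n x"
  unfolding seg'_def by (intro prod_pos ballI deriv_pos seg_in) auto

lemma seg_continuous:
  "k \<le> n \<Longrightarrow> continuous_on {-M..M} (seg a k n)"
proof (induction n rule: dec_induct)
  case base
  then show ?case by (simp add: continuous_on_id)
next
  case (step n)
  have "continuous_on {-M..M} (a n)"
    using deriv by (intro DERIV_continuous_on)
  then have "continuous_on {-M..M} (seg a k n \<circ> a n)"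
    using maps by (intro continuous_on_compose continuous_on_subset[OF step.IH]) blast+
  moreover have "seg a k n \<circ> a n = seg a k (Suc n)"
    using step.hyps by (simp add: fun_eq_iff seg_Suc_right)
  ultimately show ?case by simp
qed

lemma seg_strict_mono: "strict_mono_on {-M..M} (seg a 0 n)"
proof (rule strict_mono_onI)
  show "seg a 0 n x < seg a 0 n y" if "x \<in> {-M..M}" "y \<in> {-M..M}" "x < y" for x y
    using that
  proof (induction n arbitrary: x y)
    case (Suc n)
    have "c * (y - x) \<le> a n y - a n x"
      using Suc.prems deriv_lower deriv_upper
      by (intro increment_bounds(1)[OF deriv, where B = Q]) auto
    moreover have "0 < c * (y - x)" using Suc.prems(3) c_pos by simp
    ultimately have "a n x < a n y" by linarith
    then show ?case
      using Suc.IH[OF maps[OF Suc.prems(1)] maps[OF Suc.prems(2)]] by (simp only: seg_Suc_right[OF le0])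
  qed simp
qed

lemma seg_inj: "inj_on (seg a 0 n) {-M..M}"
  using seg_strict_mono by (rule strict_mono_on_imp_inj_on)

lemma seg_mono: "\<lbrakk>x \<in> {-M..M}; y \<in> {-M..M}; x \<le> y\<rbrakk> \<Longrightarrow> seg a 0 n x \<le> seg a 0 n y"
  using seg_strict_mono strict_mono_on_leD by blast

lemma seg_image: "seg a 0 n ` {-M..M} = {low n..high n}"
proof
  show "seg a 0 n ` {-M..M} \<subseteq> {low n..high n}"
    using M_pos by (auto simp: low_def high_def intro!: seg_mono)
  show "{low n..high n} \<subseteq> seg a 0 n ` {-M..M}"
  proof
    fix y assume "y \<in> {low n..high n}"
    then have "\<exists>x. - M \<le> x \<and> x \<le> M \<and> seg a 0 n x = y"
      using M_pos seg_continuous[of 0 n] by (intro IVT') (auto simp: low_def high_def)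
    then show "y \<in> seg a 0 n ` {-M..M}" by auto
  qed
qed

lemma low_less_high: "low n < high n"
  unfolding low_def high_def
  using M_pos by (intro strict_mono_onD[OF seg_strict_mono]) auto

lemma low_in: "low n \<in> {-M..M}" and high_in: "high n \<in> {-M..M}"
  unfolding low_def high_def using M_pos by (intro seg_in; simp)+

lemma incseq_low: "incseq low"
proof (rule incseq_SucI)
  fix n
  have "a n (-M) \<in> {-M..M}" using M_pos by (intro maps) auto
  then show "low n \<le> low (Suc n)"
    unfolding low_def seg_Suc_right[OF le0] using M_pos by (intro seg_mono) auto
qed

lemma decseq_high: "decseq high"
proof (rule decseq_SucI)
  fix n
  have "a n M \<in> {-M..M}" using M_pos by (intro maps) auto
  then show "high (Suc n) \<le> high n"
    unfolding high_def seg_Suc_right[OF le0] using M_pos by (intro seg_mono) auto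
qed

lemma low_tendsto: "low \<longlonglongrightarrow> lim low"
proof -
  have "\<forall>n. low n \<le> M" using low_in by simp
  then obtain l where "low \<longlonglongrightarrow> l"
    by (rule incseq_convergent[OF incseq_low])
  then show ?thesis by (simp add: limI)
qed

lemma high_tendsto: "high \<longlonglongrightarrow> lim high"
proof -
  have "\<forall>n. - M \<le> high n" using high_in by simp
  then obtain l where "high \<longlonglongrightarrow> l"
    by (rule decseq_convergent[OF decseq_high])
  then show ?thesis by (simp add: limI)
qed

lemma low_le_high_lim: "lim low \<le> lim high"
  using low_less_high by (intro LIMSEQ_le[OF low_tendsto high_tendsto]) (auto intro: less_imp_le)

lemma core_subset: "core \<subseteq> {low n..high n}"
  using incseq_le[OF incseq_low low_tendsto, of n] decseq_ge[OF decseq_high high_tendsto, of n]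
  by (auto simp: core_def)

lemma pull_in: "y \<in> {low n..high n} \<Longrightarrow> pull n y \<in> {-M..M}"
  unfolding seg_image[symmetric] by (rule inv_into_into)

lemma seg_pull: "y \<in> {low n..high n} \<Longrightarrow> seg a 0 n (pull n y) = y"
  unfolding seg_image[symmetric] by (rule f_inv_into_f)

lemma pull_seg: "x \<in> {-M..M} \<Longrightarrow> pull n (seg a 0 n x) = x"
  using seg_inj by (rule inv_into_f_f)

lemma pull_continuous: "continuous_on {low n..high n} (pull n)"
  unfolding seg_image[symmetric]
  using seg_continuous seg_inj by (intro continuous_on_inv) (auto simp: pull_seg)

lemma pull_deriv:
  assumes "y \<in> {low n..high n}"
  shows "(pull n has_real_derivative inverse (seg' n (pull n y))) (at y within {low n..high n})"
proof -
  have x: "pull n y \<in> {-M..M}" using pull_in[OF assms] .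
  have "(pull n has_real_derivative inverse (seg' n (pull n y)))
      (at (seg a 0 n (pull n y)) within seg a 0 n ` {-M..M})"
    using seg_inj seg_continuous x seg_deriv[OF x] seg'_pos[OF x, of n]
    by (intro has_real_derivative_inv_into) auto
  then show ?thesis
    by (simp only: seg_image seg_pull[OF assms])
qed

text \<open>
  The preimages of a fixed point form one backward orbit.  This coherence lets the holonomies of
  consecutive orders be compared.
\<close>
lemma pull_Suc:
  assumes "y \<in> {low (Suc n)..high (Suc n)}"
  shows "pull n y = a n (pull (Suc n) y)"
proof -
  have x: "pull (Suc n) y \<in> {-M..M}" using pull_in[OF assms] .
  have "y = seg a 0 n (a n (pull (Suc n) y))"
    using seg_pull[OF assms] by (simp add: seg_Suc_right)
  then show ?thesis
    using pull_seg[OF maps[OF x]] by metis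
qed

end


section \<open>Two asymptotic sequences of interval maps\<close>

text \<open>
  The rate \<open>\<alpha>\<close> at which the maps approach each other must beat their expansion \<open>Q\<close>.
  Being only an upper bound, \<open>Q\<close> can be taken above \<open>1\<close>, so that the sum of its powers up to
  some exponent is of the order of the last one.
\<close>
locale asymptotic_interval_maps =
  A: interval_map_sequence M c Q K a a' + B: interval_map_sequence M c Q K b b'
  for M c Q K a a' b b' +
  fixes L \<alpha> :: real
  assumes Q_gt_1: "1 < Q" and alpha_pos: "0 < \<alpha>" and alpha_Q: "\<alpha> * Q < 1" and K_nonneg: "0 \<le> K"
    and close: "x \<in> {-M..M} \<Longrightarrow> \<bar>b n x - a n x\<bar> \<le> L * \<alpha> ^ n"
    and close_deriv: "x \<in> {-M..M} \<Longrightarrow> \<bar>b' n x - a' n x\<bar> \<le> L * \<alpha> ^ n"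
begin

text \<open>
  \<open>W\<close> bounds the distance of corresponding orbit points relative to \<open>\<alpha>\<^sup>k\<close>, as the sum of a
  geometric series: an error of size \<open>L \<alpha>\<^sup>j\<close> made at level \<open>j\<close> is expanded by
  \<open>Q\<^bsup>j-k\<^esup>\<close> on its way to level \<open>k\<close>.  \<open>U\<close> is the resulting bound for the level-\<open>i\<close>
  contribution to the logarithmic derivative relative to \<open>\<alpha>\<^sup>i\<close>, and \<open>E\<close> the sum of
  these bounds over all levels.
\<close>
definition W :: real where "W = L / (1 - \<alpha> * Q)"
definition U :: real where "U = K * W * \<alpha> + L / c"
definition E :: real where "E = U / (1 - \<alpha>)"

lemma L_nonneg: "0 \<le> L"
  using close[of M 0] A.M_pos by auto

lemma alpha_less: "\<alpha> < \<alpha> * Q"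
  using Q_gt_1 alpha_pos by simp

lemma alpha_less_1: "\<alpha> < 1"
  using alpha_less alpha_Q by linarith

lemma W_nonneg: "0 \<le> W" and U_nonneg: "0 \<le> U"
  using L_nonneg alpha_Q K_nonneg alpha_pos A.c_pos by (auto simp: W_def U_def)

text \<open>
  Induction on the outermost index: the inner distance \<open>W \<alpha>\<^bsup>k+1\<^esup>\<close> is expanded by at most
  \<open>Q\<close>, and exchanging \<open>b k\<close> for \<open>a k\<close> adds \<open>L \<alpha>\<^sup>k\<close>.  The constant \<open>W\<close> is the fixed point
  of this recursion, \<open>\<alpha> Q W + L = W\<close>.
\<close>
lemma seg_close:
  assumes "k \<le> n" "x \<in> {-M..M}"
  shows "\<bar>seg b k n x - seg a k n x\<bar> \<le> W * \<alpha> ^ k"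
  using assms(1)
proof (induction k rule: inc_induct)
  case base
  then show ?case using W_nonneg alpha_pos by simp
next
  case (step k)
  let ?p = "seg b (Suc k) n x" and ?q = "seg a (Suc k) n x"
  have p: "?p \<in> {-M..M}" and q: "?q \<in> {-M..M}"
    using step.hyps assms by (auto intro!: A.seg_in B.seg_in simp del: atLeastAtMost_iff)
  have "\<bar>b k ?p - b k ?q\<bar> \<le> Q * (W * \<alpha> ^ Suc k)"
    using B.step_lipschitz[OF p q, of k] step.IH Q_gt_1
    by (meson mult_left_mono order_trans zero_le_one less_imp_le)
  moreover have "\<bar>b k ?q - a k ?q\<bar> \<le> L * \<alpha> ^ k"
    using close[OF q] .
  moreover have "Q * (W * \<alpha> ^ Suc k) + L * \<alpha> ^ k = W * \<alpha> ^ k"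
    using alpha_Q by (simp add: W_def field_simps)
  ultimately have "\<bar>b k ?p - a k ?q\<bar> \<le> W * \<alpha> ^ k"
    by linarith
  then show ?case
    using step.hyps by (simp add: seg_left)
qed

text \<open>
  Here \<open>x\<close> is the innermost point.  At the point \<open>seg a 0 n x\<close> the holonomy of order \<open>n\<close> has
  derivative \<open>exp (log_deriv n x)\<close>, and \<open>log_ratio i n x\<close> is the contribution of the maps
  \<open>a i\<close> and \<open>b i\<close>.
\<close>
definition log_ratio :: "nat \<Rightarrow> nat \<Rightarrow> real \<Rightarrow> real" where
  "log_ratio i n x = ln (b' i (seg b (Suc i) n x)) - ln (a' i (seg a (Suc i) n x))"

definition log_deriv :: "nat \<Rightarrow> real \<Rightarrow> real" where
  "log_deriv n x = (\<Sum>i<n. log_ratio i n x)"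

text \<open>
  Two errors: the orbits are at slightly different points, which \<open>distortion\<close> controls, and the
  two maps have slightly different derivatives, which the lower bound \<open>c\<close> turns into a
  difference of logarithms.
\<close>
lemma log_ratio_bound:
  assumes "i < n" "x \<in> {-M..M}"
  shows "\<bar>log_ratio i n x\<bar> \<le> U * \<alpha> ^ i"
proof -
  let ?p = "seg b (Suc i) n x" and ?q = "seg a (Suc i) n x"
  have p: "?p \<in> {-M..M}" and q: "?q \<in> {-M..M}"
    using assms by (auto intro!: A.seg_in B.seg_in simp del: atLeastAtMost_iff)
  have "\<bar>ln (b' i ?p) - ln (b' i ?q)\<bar> \<le> K * \<bar>?p - ?q\<bar>"
    by (rule B.distortion[OF p q])
  also have "\<dots> \<le> K * (W * \<alpha> ^ Suc i)"
    using assms K_nonneg by (intro mult_left_mono seg_close) auto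
  finally have 1: "\<bar>ln (b' i ?p) - ln (b' i ?q)\<bar> \<le> K * (W * \<alpha> ^ Suc i)" .
  have "\<bar>ln (b' i ?q) - ln (a' i ?q)\<bar> \<le> \<bar>b' i ?q - a' i ?q\<bar> / c"
    by (rule abs_ln_diff_le[OF A.c_pos B.deriv_lower[OF q] A.deriv_lower[OF q]])
  also have "\<dots> \<le> L * \<alpha> ^ i / c"
    using close_deriv[OF q] A.c_pos by (intro divide_right_mono) auto
  finally have "\<bar>ln (b' i ?q) - ln (a' i ?q)\<bar> \<le> L * \<alpha> ^ i / c" .
  with 1 have "\<bar>log_ratio i n x\<bar> \<le> K * (W * \<alpha> ^ Suc i) + L * \<alpha> ^ i / c"
    unfolding log_ratio_def by linarith
  also have "\<dots> = U * \<alpha> ^ i"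
    by (simp add: U_def algebra_simps)
  finally show ?thesis .
qed

lemma log_deriv_bound:
  assumes "x \<in> {-M..M}"
  shows "\<bar>log_deriv n x\<bar> \<le> E"
proof -
  have "\<bar>log_deriv n x\<bar> \<le> (\<Sum>i<n. U * \<alpha> ^ i)"
    unfolding log_deriv_def
    using assms by (intro order_trans[OF sum_abs] sum_mono log_ratio_bound) auto
  also have "\<dots> = U * ((1 - \<alpha> ^ n) / (1 - \<alpha>))"
    using alpha_less_1 by (simp add: sum_distrib_left[symmetric] sum_gp_strict)
  also have "\<dots> \<le> U * (1 / (1 - \<alpha>))"
    using U_nonneg alpha_less_1 alpha_pos by (intro mult_left_mono divide_right_mono) auto
  finally show ?thesis by (simp add: E_def)
qed

text \<open>
  \<open>x\<close> and \<open>a n x\<close> are the innermost points of the same \<open>a\<close>-orbit, so all terms with \<open>a'\<close>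
  below level \<open>n\<close> cancel.  The \<open>b\<close>-orbits start at \<open>b n x\<close> and \<open>a n x\<close>, at distance
  at most \<open>L \<alpha>\<^sup>n\<close>, which grows by at most \<open>Q\<close> per level on the way out.
\<close>
lemma log_deriv_step:
  assumes "x \<in> {-M..M}"
  shows "\<bar>log_deriv (Suc n) x - log_deriv n (a n x)\<bar> \<le> (U + K * L / (Q - 1)) * (\<alpha> * Q) ^ n"
proof -
  have Q: "0 \<le> Q" using Q_gt_1 by simp
  have ax: "a n x \<in> {-M..M}" and bx: "b n x \<in> {-M..M}"
    using A.maps[OF assms] B.maps[OF assms] by auto
  have summand: "\<bar>log_ratio i (Suc n) x - log_ratio i n (a n x)\<bar> \<le> K * L * \<alpha> ^ n * Q ^ (n - Suc i)"
    if "i < n" for i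
  proof -
    let ?p = "seg b (Suc i) n (b n x)" and ?q = "seg b (Suc i) n (a n x)"
    have "log_ratio i (Suc n) x - log_ratio i n (a n x) = ln (b' i ?p) - ln (b' i ?q)"
      using that by (simp add: log_ratio_def seg_Suc_right)
    also have "\<bar>\<dots>\<bar> \<le> K * \<bar>?p - ?q\<bar>"
      using that ax bx by (intro B.distortion B.seg_in) auto
    also have "\<dots> \<le> K * (Q ^ (n - Suc i) * \<bar>b n x - a n x\<bar>)"
      using that ax bx K_nonneg Q by (intro mult_left_mono B.seg_lipschitz) auto
    also have "\<dots> \<le> K * (Q ^ (n - Suc i) * (L * \<alpha> ^ n))"
      using close[OF assms] K_nonneg Q by (intro mult_left_mono) auto
    finally show ?thesis by (simp add: mult_ac)
  qed
  have split: "log_deriv (Suc n) x - log_deriv n (a n x)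
      = (\<Sum>i<n. log_ratio i (Suc n) x - log_ratio i n (a n x)) + log_ratio n (Suc n) x"
    by (simp add: log_deriv_def sum_subtractf)
  have "\<bar>log_deriv (Suc n) x - log_deriv n (a n x)\<bar>
      \<le> (\<Sum>i<n. \<bar>log_ratio i (Suc n) x - log_ratio i n (a n x)\<bar>) + \<bar>log_ratio n (Suc n) x\<bar>"
    unfolding split by (rule order_trans[OF abs_triangle_ineq add_right_mono[OF sum_abs]])
  also have "\<dots> \<le> (\<Sum>i<n. K * L * \<alpha> ^ n * Q ^ (n - Suc i)) + U * \<alpha> ^ n"
    using assms by (intro add_mono sum_mono summand log_ratio_bound) auto
  also have "(\<Sum>i<n. K * L * \<alpha> ^ n * Q ^ (n - Suc i)) = K * L * \<alpha> ^ n * (\<Sum>i<n. Q ^ i)"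
    by (simp add: sum_distrib_left[symmetric] sum.nat_diff_reindex[of "\<lambda>i. Q ^ i"])
  also have "(\<Sum>i<n. Q ^ i) = (Q ^ n - 1) / (Q - 1)"
    using Q_gt_1 by (intro geometric_sum) auto
  also have "K * L * \<alpha> ^ n * ((Q ^ n - 1) / (Q - 1)) \<le> K * L * \<alpha> ^ n * (Q ^ n / (Q - 1))"
    using K_nonneg L_nonneg alpha_pos Q_gt_1 by (intro mult_left_mono divide_right_mono) auto
  also have "K * L * \<alpha> ^ n * (Q ^ n / (Q - 1)) + U * \<alpha> ^ n
      \<le> K * L * \<alpha> ^ n * (Q ^ n / (Q - 1)) + U * (\<alpha> * Q) ^ n"
    using U_nonneg alpha_less alpha_pos by (intro add_left_mono mult_left_mono power_mono) auto
  also have "\<dots> = (U + K * L / (Q - 1)) * (\<alpha> * Q) ^ n"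
    by (simp add: power_mult_distrib algebra_simps)
  finally show ?thesis by simp
qed


section \<open>The holonomy between the two sequences\<close>

definition hol :: "nat \<Rightarrow> real \<Rightarrow> real" where
  "hol n y = seg b 0 n (A.pull n y)"

definition hol' :: "nat \<Rightarrow> real \<Rightarrow> real" where
  "hol' n y = exp (log_deriv n (A.pull n y))"

definition hol_lim :: "real \<Rightarrow> real" where
  "hol_lim y = lim (\<lambda>n. hol n y)"

definition hol'_lim :: "real \<Rightarrow> real" where
  "hol'_lim y = exp (lim (\<lambda>n. log_deriv n (A.pull n y)))"

lemma exp_log_deriv:
  assumes "x \<in> {-M..M}"
  shows "exp (log_deriv n x) = B.seg' n x / A.seg' n x"
proof -
  have "exp (log_ratio i n x) = b' i (seg b (Suc i) n x) / a' i (seg a (Suc i) n x)" if "i < n" for i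
  proof -
    have "0 < b' i (seg b (Suc i) n x)" "0 < a' i (seg a (Suc i) n x)"
      using assms that by (auto intro!: A.deriv_pos B.deriv_pos A.seg_in B.seg_in simp del: atLeastAtMost_iff)
    then show ?thesis by (simp add: log_ratio_def exp_diff)
  qed
  then show ?thesis
    by (simp add: log_deriv_def exp_sum A.seg'_def B.seg'_def prod_dividef)
qed

lemma hol_deriv:
  assumes "y \<in> {A.low n..A.high n}"
  shows "(hol n has_real_derivative hol' n y) (at y within {A.low n..A.high n})"
proof -
  have x: "A.pull n y \<in> {-M..M}" using A.pull_in[OF assms] .
  have "(seg b 0 n has_real_derivative B.seg' n (A.pull n y))
      (at (A.pull n y) within A.pull n ` {A.low n..A.high n})"
    using A.pull_in by (intro DERIV_subset[OF B.seg_deriv[OF x]]) blast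
  then have "(seg b 0 n \<circ> A.pull n has_real_derivative
      B.seg' n (A.pull n y) * inverse (A.seg' n (A.pull n y))) (at y within {A.low n..A.high n})"
    by (intro DERIV_image_chain A.pull_deriv assms)
  moreover have "seg b 0 n \<circ> A.pull n = hol n"
    by (simp add: fun_eq_iff hol_def)
  ultimately show ?thesis
    by (simp add: hol'_def exp_log_deriv[OF x] divide_inverse)
qed

text \<open>
  These bounds hold on the whole interval of order \<open>n\<close>, which is larger than the core.  The
  endpoints \<open>A.low n\<close> and \<open>A.high n\<close> in general lie outside the core, and their images are
  compared with those of core points.
\<close>
lemma hol'_bounds:
  assumes "y \<in> {A.low n..A.high n}"
  shows "exp (- E) \<le> hol' n y \<and> hol' n y \<le> exp E"
  using log_deriv_bound[OF A.pull_in[OF assms], of n] by (auto simp: hol'_def)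

lemma hol_bilipschitz:
  assumes "A.low n \<le> x" "x \<le> y" "y \<le> A.high n"
  shows "exp (- E) * (y - x) \<le> hol n y - hol n x" and "hol n y - hol n x \<le> exp E * (y - x)"
  using increment_bounds[OF hol_deriv hol'_bounds assms] by auto

lemma hol_endpoints: "hol n (A.low n) = B.low n" "hol n (A.high n) = B.high n"
  using A.M_pos by (simp_all add: hol_def A.low_def A.high_def B.low_def B.high_def A.pull_seg)

lemma hol_image: "hol n ` {A.low n..A.high n} \<subseteq> {B.low n..B.high n}"
  unfolding hol_def B.seg_image[symmetric] using A.pull_in by blast

lemma hol_step:
  assumes "y \<in> A.core"
  shows "\<bar>hol (Suc n) y - hol n y\<bar> \<le> L * (\<alpha> * Q) ^ n"
proof -
  have y: "y \<in> {A.low (Suc n)..A.high (Suc n)}" using A.core_subset assms by blast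
  let ?x = "A.pull (Suc n) y"
  have x: "?x \<in> {-M..M}" using A.pull_in[OF y] .
  have "\<bar>hol (Suc n) y - hol n y\<bar> = \<bar>seg b 0 n (b n ?x) - seg b 0 n (a n ?x)\<bar>"
    by (simp add: hol_def seg_Suc_right A.pull_Suc[OF y])
  also have "\<dots> \<le> Q ^ (n - 0) * \<bar>b n ?x - a n ?x\<bar>"
    using Q_gt_1 A.maps[OF x] B.maps[OF x] by (intro B.seg_lipschitz) auto
  also have "\<dots> \<le> Q ^ n * (L * \<alpha> ^ n)"
    using Q_gt_1 close[OF x, of n] by (simp add: mult_left_mono)
  finally show ?thesis
    by (simp add: power_mult_distrib mult_ac)
qed

lemma hol_uniform_limit: "uniform_limit A.core hol hol_lim sequentially"
  unfolding hol_lim_def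
  using hol_step alpha_pos Q_gt_1 alpha_Q
  by (intro uniform_limit_lim_of_geometric_increments[where B = L and r = "\<alpha> * Q"]) auto

text \<open>
  Convergence is proved for the logarithms, where increments add up; their uniform bound \<open>E\<close>
  confines them to a compact interval, on which \<open>exp\<close> is uniformly continuous.
\<close>
lemma hol'_uniform_limit: "uniform_limit A.core hol' hol'_lim sequentially"
proof -
  define v where "v n y = log_deriv n (A.pull n y)" for n y
  have v: "v n y \<in> {-E..E}" if "y \<in> A.core" for n y
    using log_deriv_bound[OF A.pull_in, of y n n] A.core_subset[of n] that
    by (auto simp: v_def abs_le_iff)
  have ul: "uniform_limit A.core v (\<lambda>y. lim (\<lambda>n. v n y)) sequentially"
  proof (rule uniform_limit_lim_of_geometric_increments)
    fix n y assume "y \<in> A.core"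
    then have y: "y \<in> {A.low (Suc n)..A.high (Suc n)}" using A.core_subset by blast
    show "\<bar>v (Suc n) y - v n y\<bar> \<le> (U + K * L / (Q - 1)) * (\<alpha> * Q) ^ n"
      using log_deriv_step[OF A.pull_in[OF y], of n] by (simp add: v_def A.pull_Suc[OF y])
  qed (use alpha_pos Q_gt_1 alpha_Q in auto)
  have "lim (\<lambda>n. v n y) \<in> {-E..E}" if "y \<in> A.core" for y
    using v[OF that] tendsto_uniform_limitI[OF ul that]
    by (rule closed_sequentially[OF closed_atLeastAtMost])
  then have "(\<lambda>y. lim (\<lambda>n. v n y)) ` A.core \<subseteq> {-E..E}"
    by blast
  then have "uniform_limit A.core (\<lambda>n y. exp (v n y)) (exp \<circ> (\<lambda>y. lim (\<lambda>n. v n y))) sequentially"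
    using v by (intro uniform_limit_compose[OF ul, of "{-E..E}"] compact_uniformly_continuous
        continuous_on_exp continuous_on_id always_eventually) auto
  then show ?thesis
    by (simp add: v_def hol'_def[abs_def] hol'_lim_def[abs_def] o_def)
qed

lemma hol'_lim_pos: "0 < hol'_lim y"
  by (simp add: hol'_lim_def)

lemma log_deriv_continuous: "continuous_on {-M..M} (log_deriv n)"
proof -
  have "continuous_on {-M..M} (\<lambda>x. log_ratio i n x)" if "i < n" for i
  proof -
    have "continuous_on {-M..M} (\<lambda>x. a' i (seg a (Suc i) n x))"
      using that A.seg_in by (intro continuous_on_compose2[OF A.deriv_continuous A.seg_continuous]) auto
    moreover have "continuous_on {-M..M} (\<lambda>x. b' i (seg b (Suc i) n x))"
      using that B.seg_in by (intro continuous_on_compose2[OF B.deriv_continuous B.seg_continuous]) auto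
    moreover have "a' i (seg a (Suc i) n x) \<noteq> 0" "b' i (seg b (Suc i) n x) \<noteq> 0"
      if "x \<in> {-M..M}" for x
      using A.deriv_pos[OF A.seg_in[of "Suc i" n x], of i]
        B.deriv_pos[OF B.seg_in[of "Suc i" n x], of i] that \<open>i < n\<close> by auto
    ultimately show ?thesis
      unfolding log_ratio_def by (intro continuous_on_diff continuous_on_ln) auto
  qed
  then have "continuous_on {-M..M} (\<lambda>x. \<Sum>i<n. log_ratio i n x)"
    by (intro continuous_on_sum) auto
  then show ?thesis
    by (simp add: log_deriv_def[abs_def])
qed

lemma hol'_continuous: "continuous_on {A.low n..A.high n} (hol' n)"
  unfolding hol'_def
  using A.pull_in
  by (intro continuous_on_exp continuous_on_compose2[OF log_deriv_continuous A.pull_continuous]) blast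

lemma hol'_lim_continuous: "continuous_on A.core hol'_lim"
  using A.core_subset
  by (intro uniform_limit_theorem[OF always_eventually hol'_uniform_limit]
      allI continuous_on_subset[OF hol'_continuous]) auto

lemma hol_lim_tendsto: "y \<in> A.core \<Longrightarrow> (\<lambda>n. hol n y) \<longlonglongrightarrow> hol_lim y"
  using hol_uniform_limit by (rule tendsto_uniform_limitI)

lemma hol_lim_deriv:
  assumes "y \<in> A.core"
  shows "(hol_lim has_real_derivative hol'_lim y) (at y within A.core)"
proof -
  have conv: "\<forall>\<^sub>F n in sequentially. \<forall>x\<in>A.core. \<forall>h. norm (hol' n x * h - hol'_lim x * h) \<le> e * norm h"
    if "0 < e" for e
    using uniform_limitD[OF hol'_uniform_limit that]
  proof eventually_elim
    case (elim n)
    show ?case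
    proof (intro ballI allI)
      fix x h assume "x \<in> A.core"
      with elim have "\<bar>hol' n x - hol'_lim x\<bar> \<le> e" by (auto simp: dist_real_def less_imp_le)
      then have "\<bar>hol' n x - hol'_lim x\<bar> * \<bar>h\<bar> \<le> e * \<bar>h\<bar>" by (intro mult_right_mono) auto
      then show "norm (hol' n x * h - hol'_lim x * h) \<le> e * norm h"
        by (simp add: abs_mult[symmetric] left_diff_distrib)
    qed
  qed
  have deriv: "(hol n has_derivative (*) (hol' n x)) (at x within A.core)" if "x \<in> A.core" for n x
    using A.core_subset that
    by (intro has_field_derivative_imp_has_derivative DERIV_subset[OF hol_deriv]) blast+
  have "convex A.core" by (simp add: A.core_def)
  then have "\<exists>g. \<forall>x\<in>A.core. (\<lambda>n. hol n x) \<longlonglongrightarrow> g x \<and>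
      (g has_derivative (*) (hol'_lim x)) (at x within A.core)"
    by (rule has_derivative_sequence[where f' = "\<lambda>n x. (*) (hol' n x)",
          OF _ deriv conv assms hol_lim_tendsto[OF assms]])
  then obtain g where g: "\<And>x. x \<in> A.core \<Longrightarrow> (\<lambda>n. hol n x) \<longlonglongrightarrow> g x"
    and g': "(g has_derivative (*) (hol'_lim y)) (at y within A.core)"
    using assms by blast
  have "g x = hol_lim x" if "x \<in> A.core" for x
    using g[OF that] hol_lim_tendsto[OF that] by (rule LIMSEQ_unique)
  then show ?thesis
    unfolding has_field_derivative_def
    by (intro has_derivative_transform[OF assms _ g']) auto
qed

lemma hol_lim_continuous: "continuous_on A.core hol_lim"
  using hol_lim_deriv by (rule DERIV_continuous_on)

text \<open>The lower Lipschitz bound survives the limit; mere monotonicity would not stay strict.\<close>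
lemma hol_lim_strict_mono: "strict_mono_on A.core hol_lim"
proof (rule strict_mono_onI)
  fix x y assume xy: "x \<in> A.core" "y \<in> A.core" "x < y"
  have "exp (- E) * (y - x) \<le> hol_lim y - hol_lim x"
  proof (rule LIMSEQ_le_const)
    show "(\<lambda>n. hol n y - hol n x) \<longlonglongrightarrow> hol_lim y - hol_lim x"
      using xy by (intro tendsto_diff hol_lim_tendsto)
    show "\<exists>N. \<forall>n\<ge>N. exp (- E) * (y - x) \<le> hol n y - hol n x"
    proof (intro exI allI impI hol_bilipschitz(1))
      fix n
      show "A.low n \<le> x" "y \<le> A.high n" using A.core_subset[of n] xy by auto
    qed (use xy in auto)
  qed
  moreover have "0 < exp (- E) * (y - x)" using xy by simp
  ultimately show "hol_lim x < hol_lim y" by linarith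
qed

lemma lims_in_core: "lim A.low \<in> A.core" "lim A.high \<in> A.core"
  using A.low_le_high_lim by (auto simp: A.core_def)

text \<open>
  The points \<open>x n\<close> may lie outside the core, where the holonomies need not converge; the uniform
  Lipschitz bound transfers the convergence from \<open>y\<close>.
\<close>
lemma hol_tendsto_moving_point:
  assumes "\<And>n. x n \<in> {A.low n..A.high n}" "x \<longlonglongrightarrow> y" "y \<in> A.core"
  shows "(\<lambda>n. hol n (x n)) \<longlonglongrightarrow> hol_lim y"
proof -
  have bound: "norm (hol n (x n) - hol n y) \<le> exp E * \<bar>x n - y\<bar>" for n
  proof -
    have y: "A.low n \<le> y" "y \<le> A.high n" using A.core_subset[of n] assms(3) by auto
    have lipschitz: "\<bar>hol n t - hol n s\<bar> \<le> exp E * \<bar>t - s\<bar>"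
      if "A.low n \<le> s" "s \<le> t" "t \<le> A.high n" for s t
    proof -
      have "0 \<le> exp (- E) * (t - s)" using that by simp
      with hol_bilipschitz[OF that] have "0 \<le> hol n t - hol n s" "hol n t - hol n s \<le> exp E * (t - s)"
        by linarith+
      then show ?thesis using that by simp
    qed
    show ?thesis
      using lipschitz[of y "x n"] lipschitz[of "x n" y] assms(1)[of n] y
      by (cases "x n \<le> y") (auto simp: abs_minus_commute)
  qed
  have "(\<lambda>n. exp E * \<bar>x n - y\<bar>) \<longlonglongrightarrow> exp E * \<bar>y - y\<bar>"
    by (intro tendsto_intros assms)
  then have "(\<lambda>n. exp E * \<bar>x n - y\<bar>) \<longlonglongrightarrow> 0" by simp
  then have "(\<lambda>n. hol n (x n) - hol n y) \<longlonglongrightarrow> 0"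
    by (rule Lim_null_comparison[OF always_eventually[OF allI[OF bound]]])
  from tendsto_add[OF this hol_lim_tendsto[OF assms(3)]] show ?thesis by simp
qed

lemma hol_lim_endpoints: "hol_lim (lim A.low) = lim B.low" "hol_lim (lim A.high) = lim B.high"
proof -
  have "B.low \<longlonglongrightarrow> hol_lim (lim A.low)" "B.high \<longlonglongrightarrow> hol_lim (lim A.high)"
    using hol_tendsto_moving_point[of A.low "lim A.low", OF _ A.low_tendsto lims_in_core(1)]
      hol_tendsto_moving_point[of A.high "lim A.high", OF _ A.high_tendsto lims_in_core(2)]
      A.low_less_high by (simp_all add: hol_endpoints less_imp_le)
  then show "hol_lim (lim A.low) = lim B.low" "hol_lim (lim A.high) = lim B.high"
    by (simp_all add: limI)
qed

lemma hol_lim_image: "hol_lim ` A.core = B.core"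
proof
  show "hol_lim ` A.core \<subseteq> B.core"
  proof
    fix z assume "z \<in> hol_lim ` A.core"
    then obtain y where y: "y \<in> A.core" "z = hol_lim y" by blast
    then have "hol_lim (lim A.low) \<le> z" "z \<le> hol_lim (lim A.high)"
      using strict_mono_on_leD[OF hol_lim_strict_mono] lims_in_core by (auto simp: A.core_def)
    then show "z \<in> B.core" by (simp add: hol_lim_endpoints B.core_def)
  qed
  show "B.core \<subseteq> hol_lim ` A.core"
  proof
    fix z assume "z \<in> B.core"
    then have "\<exists>y. lim A.low \<le> y \<and> y \<le> lim A.high \<and> hol_lim y = z"
      using hol_lim_continuous A.low_le_high_lim
      by (intro IVT') (auto simp: A.core_def B.core_def hol_lim_endpoints)
    then show "z \<in> hol_lim ` A.core" by (auto simp: A.core_def)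
  qed
qed

lemma hol_lim_diffeo:
  assumes "lim A.low < lim A.high"
  shows "orientation_preserving_diffeo_on A.core B.core hol_lim"
proof -
  let ?inv = "inv_into A.core hol_lim"
  have inj: "inj_on hol_lim A.core"
    using hol_lim_strict_mono by (rule strict_mono_on_imp_inj_on)
  have less: "lim B.low < lim B.high"
    using strict_mono_onD[OF hol_lim_strict_mono _ _ assms] lims_in_core
    by (simp add: hol_lim_endpoints)
  have inv_cont: "continuous_on B.core ?inv"
    unfolding hol_lim_image[symmetric] using inj hol_lim_continuous
    by (intro continuous_on_inv) (auto simp: A.core_def)
  have inv_deriv: "(?inv has_real_derivative inverse (hol'_lim (?inv z))) (at z within B.core)"
    if "z \<in> B.core" for z
  proof -
    have z: "?inv z \<in> A.core" "hol_lim (?inv z) = z"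
      using that by (auto simp: hol_lim_image[symmetric] inv_into_into f_inv_into_f)
    have "(?inv has_real_derivative inverse (hol'_lim (?inv z)))
        (at (hol_lim (?inv z)) within hol_lim ` A.core)"
      using inj hol_lim_continuous z hol_lim_deriv hol'_lim_pos[of "?inv z"]
      by (intro has_real_derivative_inv_into) (auto simp: A.core_def)
    then show ?thesis by (simp only: z(2) hol_lim_image)
  qed
  have "Ck_on 1 A.core hol_lim"
  proof -
    have "deriv_on A.core hol_lim y = hol'_lim y" if "y \<in> A.core" for y
      using assms that hol_lim_deriv[OF that] unfolding A.core_def by (intro deriv_on_eqI)
    then have "continuous_on A.core (deriv_on A.core hol_lim)"
      using hol'_lim_continuous by (simp cong: continuous_on_cong)
    moreover have "hol_lim differentiable_on A.core"
      using hol_lim_deriv by (auto simp: differentiable_on_def real_differentiable_def)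
    ultimately show ?thesis by simp
  qed
  moreover have "Ck_on 1 B.core ?inv"
  proof -
    have "deriv_on B.core ?inv z = inverse (hol'_lim (?inv z))" if "z \<in> B.core" for z
      using less that inv_deriv[OF that] unfolding B.core_def by (intro deriv_on_eqI)
    moreover have "continuous_on B.core (\<lambda>z. inverse (hol'_lim (?inv z)))"
      using hol'_lim_pos
      by (intro continuous_on_inverse continuous_on_compose2[OF hol'_lim_continuous inv_cont])
        (auto simp: hol_lim_image[symmetric] inv_into_into less_imp_neq[THEN not_sym])
    ultimately have "continuous_on B.core (deriv_on B.core ?inv)"
      by (simp cong: continuous_on_cong)
    moreover have "?inv differentiable_on B.core"
      using inv_deriv by (auto simp: differentiable_on_def real_differentiable_def)
    ultimately show ?thesis by simp
  qed
  ultimately show ?thesis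
    using inj hol_lim_image hol_lim_strict_mono
    by (simp add: orientation_preserving_diffeo_on_def bij_betw_def)
qed

end


section \<open>Fibre maps along backward orbits\<close>

lemma funpow_backward:
  assumes "bij S" "m \<le> n"
  shows "(S ^^ m) (backward S n \<theta>) = backward S (n - m) \<theta>"
  using assms(2)
proof (induction m)
  case (Suc m)
  then have "(S ^^ Suc m) (backward S n \<theta>) = S (backward S (Suc (n - Suc m)) \<theta>)"
    by (simp add: Suc_diff_Suc)
  also have "\<dots> = backward S (n - Suc m) \<theta>"
    by (simp add: backward_def surj_f_inv_f[OF bij_is_surj[OF assms(1)]])
  finally show ?case .
qed simp

text \<open>
  Forward iteration from \<open>S\<^bsup>-n\<^esup> \<theta>\<close> applies the map with index \<open>n - 1\<close> first.  The induction
  inside runs over the first \<open>m\<close> steps, which compose the indices from \<open>n - m\<close> on.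
\<close>
lemma fiter_backward_eq_seg:
  assumes "bij S"
  shows "fiter S f (backward S n \<theta>) n = seg (\<lambda>k. f (backward S (Suc k) \<theta>)) 0 n"
proof
  fix x
  let ?a = "\<lambda>k. f (backward S (Suc k) \<theta>)"
  have "fiter S f (backward S n \<theta>) m x = seg ?a (n - m) n x" if "m \<le> n" for m
    using that
  proof (induction m)
    case (Suc m)
    then have "n - Suc m < n" "Suc (n - Suc m) = n - m" by auto
    then show ?case
      using Suc funpow_backward[OF assms, of m n \<theta>] by (simp add: seg_left)
  qed simp
  from this[of n] show "fiter S f (backward S n \<theta>) n x = seg ?a 0 n x" by simp
qed

text \<open>
  The constants are uniform over all fibres and depend on no orbit, so one choice serves the orbits
  of \<open>\<theta>\<close> and \<open>\<theta>'\<close>.  The supremum of the derivatives may be at most \<open>1\<close>; since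
  \<open>\<alpha> < 1\<close>, there is still room for some \<open>Q > 1\<close> below \<open>1 / \<alpha>\<close>.
\<close>
lemma skew_setting_bounds:
  fixes f :: "'a::metric_space \<Rightarrow> real \<Rightarrow> real"
  assumes setting: "skew_setting S M f" and C: "hypothesis_C M f \<alpha>" and \<alpha>: "0 < \<alpha>" "\<alpha> < 1"
  obtains c Q K where "1 < Q" "\<alpha> * Q < 1" "0 \<le> K"
    and "\<And>\<nu>. interval_map_sequence M c Q K (\<lambda>k. f (\<nu> k)) (\<lambda>k. deriv_on {-M..M} (f (\<nu> k)))"
proof -
  let ?I = "{-M..M}"
  let ?D = "\<lambda>\<theta>. deriv_on ?I (f \<theta>)"
  let ?DL = "\<lambda>\<theta>. deriv_on ?I (\<lambda>z. ln (?D \<theta> z))"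
  have M: "0 < M" using setting by (simp add: skew_setting_def)
  have maps: "f \<theta> ` ?I \<subseteq> {-M<..<M}" and "Ck_on 3 ?I (f \<theta>)" for \<theta>
    using setting by (auto simp: skew_setting_def)
  then have diff: "f \<theta> differentiable_on ?I" and diff2: "?D \<theta> differentiable_on ?I" for \<theta>
    by (simp_all add: numeral_3_eq_3)
  have "0 < (INF (\<theta>, y) \<in> UNIV \<times> ?I. ereal (?D \<theta> y))"
    using setting by (simp add: skew_setting_def)
  then obtain c where c: "0 < c" "ereal c < (INF (\<theta>, y) \<in> UNIV \<times> ?I. ereal (?D \<theta> y))"
    using ereal_dense2 by (metis ereal_less(2))
  have lower: "c \<le> ?D \<theta> y" if "y \<in> ?I" for \<theta> y
  proof -
    have "(INF (\<theta>, y) \<in> UNIV \<times> ?I. ereal (?D \<theta> y)) \<le> ereal (?D \<theta> y)"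
      using that by (intro INF_lower2[of "(\<theta>, y)"]) auto
    with c(2) have "ereal c < ereal (?D \<theta> y)" by (rule less_le_trans)
    then show ?thesis by simp
  qed
  have le_Q: "ereal (?D \<theta> y) \<le> Q_f M f" if "y \<in> ?I" for \<theta> y
    unfolding Q_f_def using that by (intro SUP_upper2[of "(\<theta>, y)"]) auto
  have "ereal \<alpha> * Q_f M f < 1" using C by (simp add: hypothesis_C_def)
  moreover have "0 < Q_f M f"
    using le_Q[of 0 undefined] lower[of 0 undefined] c(1) M
    by (metis atLeastAtMost_iff ereal_less(2) less_le_trans neg_le_0_iff_le less_imp_le)
  \<comment> \<open>positivity is needed because \<open>\<alpha> * (- \<infinity>)\<close> would also be below \<open>1\<close>\<close>
  ultimately obtain q where q: "Q_f M f = ereal q" "\<alpha> * q < 1"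
    using \<alpha> by (cases "Q_f M f") auto
  have "max q 1 < 1 / \<alpha>" using q(2) \<alpha> by (simp add: field_simps)
  then obtain Q where Q: "max q 1 < Q" "Q < 1 / \<alpha>" using dense by blast
  have upper: "?D \<theta> y \<le> Q" if "y \<in> ?I" for \<theta> y
    using le_Q[OF that, of \<theta>] Q q by simp
  have le_K: "ereal \<bar>?DL \<theta> y\<bar> \<le> Q'_f M f" if "y \<in> ?I" for \<theta> y
    unfolding Q'_f_def using that by (intro SUP_upper2[of "(\<theta>, y)"]) auto
  have "Q'_f M f < \<infinity>" using C by (simp add: hypothesis_C_def)
  moreover have "0 \<le> Q'_f M f"
    using le_K[of 0 undefined] M
    by (metis abs_ge_zero atLeastAtMost_iff ereal_less_eq(5) less_imp_le neg_le_0_iff_le order_trans)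
  ultimately obtain K where K: "Q'_f M f = ereal K" "0 \<le> K"
    by (cases "Q'_f M f") auto
  have distortion: "\<bar>ln (?D \<theta> x) - ln (?D \<theta> y)\<bar> \<le> K * \<bar>x - y\<bar>" if "x \<in> ?I" "y \<in> ?I" for \<theta> x y
  proof -
    have "(\<lambda>z. ln (?D \<theta> z)) differentiable_on ?I"
      unfolding differentiable_on_def
    proof
      fix z assume z: "z \<in> ?I"
      have "0 < ?D \<theta> z" using lower[OF z] c(1) by (rule less_le_trans[rotated])
      then show "(\<lambda>z. ln (?D \<theta> z)) differentiable (at z within ?I)"
        using DERIV_chain'[OF has_real_derivative_deriv_on[OF diff2 z] DERIV_ln]
        by (auto simp: real_differentiable_def)
    qed
    then have "norm (ln (?D \<theta> x) - ln (?D \<theta> y)) \<le> K * norm (x - y)"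
      using that le_K K by (intro field_differentiable_bound[OF _ has_real_derivative_deriv_on]) auto
    then show ?thesis by simp
  qed
  have "interval_map_sequence M c Q K (\<lambda>k. f (\<nu> k)) (\<lambda>k. ?D (\<nu> k))" for \<nu>
  proof
    fix x y :: real and n assume x: "x \<in> ?I"
    show "f (\<nu> n) x \<in> ?I" using maps[of "\<nu> n"] x by fastforce
    show "(f (\<nu> n) has_real_derivative ?D (\<nu> n) x) (at x within ?I)"
      by (rule has_real_derivative_deriv_on[OF diff x])
    show "c \<le> ?D (\<nu> n) x" "?D (\<nu> n) x \<le> Q" by (rule lower[OF x], rule upper[OF x])
    show "\<bar>ln (?D (\<nu> n) x) - ln (?D (\<nu> n) y)\<bar> \<le> K * \<bar>x - y\<bar>" if "y \<in> ?I"
      by (rule distortion[OF x that])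
  next
    show "continuous_on ?I (?D (\<nu> n))" for n
      by (rule differentiable_imp_continuous_on[OF diff2])
  qed (rule M, rule c)
  moreover have "1 < Q" "\<alpha> * Q < 1" using Q \<alpha> by (auto simp: field_simps)
  ultimately show ?thesis using K(2) that by blast
qed

lemma hypothesis_A_pointwise:
  assumes "hypothesis_A M f"
  obtains L where "0 \<le> L"
    "\<And>\<theta> \<theta>' y. y \<in> {-M..M} \<Longrightarrow> \<bar>f \<theta> y - f \<theta>' y\<bar> \<le> L * dist \<theta> \<theta>'"
    "\<And>\<theta> \<theta>' y. y \<in> {-M..M} \<Longrightarrow>
       \<bar>deriv_on {-M..M} (f \<theta>) y - deriv_on {-M..M} (f \<theta>') y\<bar> \<le> L * dist \<theta> \<theta>'"
proof -
  let ?I = "{-M..M}"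
  obtain L where L: "(SUP y\<in>?I. ereal \<bar>f \<theta> y - f \<theta>' y\<bar>) +
      (SUP y\<in>?I. ereal \<bar>deriv_on ?I (f \<theta>) y - deriv_on ?I (f \<theta>') y\<bar>) \<le> ereal (L * dist \<theta> \<theta>')"
    for \<theta> \<theta>'
    using assms unfolding hypothesis_A_def by blast
  have sum_le: "\<bar>f \<theta> y - f \<theta>' y\<bar> + \<bar>deriv_on ?I (f \<theta>) y - deriv_on ?I (f \<theta>') y\<bar> \<le> L * dist \<theta> \<theta>'"
    if "y \<in> ?I" for \<theta> \<theta>' y
  proof -
    have "ereal \<bar>f \<theta> y - f \<theta>' y\<bar> + ereal \<bar>deriv_on ?I (f \<theta>) y - deriv_on ?I (f \<theta>') y\<bar>
        \<le> ereal (L * dist \<theta> \<theta>')"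
      using that by (intro order_trans[OF add_mono L] SUP_upper)
    then show ?thesis by simp
  qed
  have L_le: "L * dist \<theta> \<theta>' \<le> \<bar>L\<bar> * dist \<theta> \<theta>'" for \<theta> \<theta>' :: 'a
    by (intro mult_right_mono) auto
  \<comment> \<open>\<open>L\<close> may be negative when the space has a single point\<close>
  show ?thesis
  proof (rule that[of "\<bar>L\<bar>"])
    fix \<theta> \<theta>' :: 'a and y :: real assume "y \<in> ?I"
    from sum_le[OF this, of \<theta> \<theta>'] L_le[of \<theta> \<theta>']
    show "\<bar>f \<theta> y - f \<theta>' y\<bar> \<le> \<bar>L\<bar> * dist \<theta> \<theta>'"
      and "\<bar>deriv_on ?I (f \<theta>) y - deriv_on ?I (f \<theta>') y\<bar> \<le> \<bar>L\<bar> * dist \<theta> \<theta>'"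
      by linarith+
  qed simp
qed

theorem proposition2p8:
  fixes S :: "'a::metric_space \<Rightarrow> 'a"
    and M :: real
    and f :: "'a \<Rightarrow> real \<Rightarrow> real"
    and Shat :: "complex \<Rightarrow> complex"
    and p :: "'a \<Rightarrow> complex"
    and \<sigma> :: "complex \<Rightarrow> 'a"
    and C \<alpha> :: real
    and \<theta> \<theta>' :: 'a
  assumes "skew_setting S M f"
    and "hypothesis_A M f"
    and "hypothesis_B S Shat p \<sigma> C \<alpha>"
    and "hypothesis_C M f \<alpha>"
    and "in_local_stable_fibre S C \<alpha> \<theta> \<theta>'"
  shows "(\<forall>n. G_n S M f \<theta> \<theta>' n ` K_n S M f n \<theta> \<subseteq> K_n S M f n \<theta>') \<and>
    uniform_limit (K_lim S M f \<theta>) (G_n S M f \<theta> \<theta>') (G_lim S M f \<theta> \<theta>') sequentially \<and>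
    G_lim S M f \<theta> \<theta>' ` K_lim S M f \<theta> = K_lim S M f \<theta>' \<and>
    (\<exists>H. continuous_on (K_lim S M f \<theta>) H \<and>
       (\<forall>n. G_n S M f \<theta> \<theta>' n differentiable_on K_n S M f n \<theta>) \<and>
       uniform_limit (K_lim S M f \<theta>)
         (\<lambda>n. deriv_on (K_n S M f n \<theta>) (G_n S M f \<theta> \<theta>' n)) H sequentially \<and>
       (\<forall>y\<in>interior (K_lim S M f \<theta>). (G_lim S M f \<theta> \<theta>' has_real_derivative H y) (at y)) \<and>
       (phi_minus S M f \<theta> < phi_plus S M f \<theta> \<longrightarrow>
          (G_lim S M f \<theta> \<theta>' has_real_derivative H (phi_minus S M f \<theta>))
            (at_right (phi_minus S M f \<theta>)) \<and>
          (G_lim S M f \<theta> \<theta>' has_real_derivative H (phi_plus S M f \<theta>))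
            (at_left (phi_plus S M f \<theta>)))) \<and>
    (\<theta> \<notin> pinch_points S M f \<longrightarrow>
       orientation_preserving_diffeo_on (K_lim S M f \<theta>) (K_lim S M f \<theta>') (G_lim S M f \<theta> \<theta>'))"
proof -
  define a where "a k = f (backward S (Suc k) \<theta>)" for k
  define b where "b k = f (backward S (Suc k) \<theta>')" for k
  define a' where "a' k = deriv_on {-M..M} (a k)" for k
  define b' where "b' k = deriv_on {-M..M} (b k)" for k
  have bij: "bij S" using assms(1) by (simp add: skew_setting_def)
  have \<alpha>: "0 < \<alpha>" "\<alpha> < 1" using assms(3) by (auto simp: hypothesis_B_def)
  obtain c Q K where Q: "1 < Q" "\<alpha> * Q < 1" "0 \<le> K"
    and maps: "\<And>\<nu>. interval_map_sequence M c Q K (\<lambda>k. f (\<nu> k)) (\<lambda>k. deriv_on {-M..M} (f (\<nu> k)))"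
    by (rule skew_setting_bounds[OF assms(1,4) \<alpha>]) (rule that)
  obtain L where L: "0 \<le> L"
    "\<And>\<theta> \<theta>' y. y \<in> {-M..M} \<Longrightarrow> \<bar>f \<theta> y - f \<theta>' y\<bar> \<le> L * dist \<theta> \<theta>'"
    "\<And>\<theta> \<theta>' y. y \<in> {-M..M} \<Longrightarrow>
       \<bar>deriv_on {-M..M} (f \<theta>) y - deriv_on {-M..M} (f \<theta>') y\<bar> \<le> L * dist \<theta> \<theta>'"
    by (rule hypothesis_A_pointwise[OF assms(2)]) (rule that)
  \<comment> \<open>index \<open>n\<close> belongs to the fibre over \<open>S\<^bsup>-(n+1)\<^esup> \<theta>\<close>, hence the extra factor \<open>\<alpha>\<close>\<close>
  define L' where "L' = L * (C * \<alpha> * dist \<theta> \<theta>')"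
  have "L * dist (backward S (Suc n) \<theta>') (backward S (Suc n) \<theta>) \<le> L' * \<alpha> ^ n" for n
  proof -
    have "dist (backward S (Suc n) \<theta>') (backward S (Suc n) \<theta>) \<le> C * \<alpha> ^ Suc n * dist \<theta> \<theta>'"
      using assms(5) unfolding in_local_stable_fibre_def dist_commute[of "backward S (Suc n) \<theta>'"]
      by blast
    from mult_left_mono[OF this L(1)] show ?thesis
      by (simp add: L'_def mult_ac)
  qed
  note close = order_trans[OF _ this]
  interpret asymptotic_interval_maps M c Q K a a' b b' L' \<alpha>
  proof (rule asymptotic_interval_maps.intro)
    show "interval_map_sequence M c Q K a a'" "interval_map_sequence M c Q K b b'"
      unfolding a_def[abs_def] b_def[abs_def] a'_def[abs_def] b'_def[abs_def] by (rule maps)+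
    show "asymptotic_interval_maps_axioms M Q K a a' b b' L' \<alpha>"
    proof
      fix x n assume "x \<in> {-M..M}"
      then show "\<bar>b n x - a n x\<bar> \<le> L' * \<alpha> ^ n" "\<bar>b' n x - a' n x\<bar> \<le> L' * \<alpha> ^ n"
        unfolding a_def b_def a'_def b'_def by (intro close L(2,3), assumption)+
    qed (rule Q \<alpha>)+
  qed
  have fiter: "fiter S f (backward S n \<theta>) n = seg a 0 n" "fiter S f (backward S n \<theta>') n = seg b 0 n" for n
    unfolding a_def[abs_def] b_def[abs_def] by (rule fiter_backward_eq_seg[OF bij])+
  have phi: "phi_minus S M f \<theta> = lim A.low" "phi_plus S M f \<theta> = lim A.high"
    "phi_minus S M f \<theta>' = lim B.low" "phi_plus S M f \<theta>' = lim B.high"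
    by (simp_all add: phi_minus_def phi_plus_def phi_minus_n_def phi_plus_n_def fiter
        A.low_def[abs_def] A.high_def[abs_def] B.low_def[abs_def] B.high_def[abs_def])
  have K_n: "K_n S M f n \<theta> = {A.low n..A.high n}" "K_n S M f n \<theta>' = {B.low n..B.high n}" for n
    by (simp_all add: K_n_def phi_minus_n_def phi_plus_n_def fiter A.low_def A.high_def B.low_def B.high_def)
  have K_lim: "K_lim S M f \<theta> = A.core" "K_lim S M f \<theta>' = B.core"
    by (simp_all add: K_lim_def phi A.core_def B.core_def)
  have G_n: "G_n S M f \<theta> \<theta>' = hol"
    by (simp add: fun_eq_iff G_n_def hol_def fiter)
  have G_lim: "G_lim S M f \<theta> \<theta>' = hol_lim"
    by (simp add: fun_eq_iff G_lim_def hol_lim_def G_n)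
  have deriv_hol: "deriv_on {A.low n..A.high n} (hol n) y = hol' n y" if "y \<in> A.core" for n y
    using that A.core_subset by (intro deriv_on_eqI A.low_less_high hol_deriv) blast+
  have derivs_converge:
    "uniform_limit A.core (\<lambda>n. deriv_on {A.low n..A.high n} (hol n)) hol'_lim sequentially"
    by (rule uniform_limit_cong'[THEN iffD2, OF _ _ hol'_uniform_limit]) (auto simp: deriv_hol)
  have hol_differentiable: "hol n differentiable_on {A.low n..A.high n}" for n
    unfolding differentiable_on_def real_differentiable_def using hol_deriv by blast
  have interior_deriv: "(hol_lim has_real_derivative hol'_lim y) (at y)" if "y \<in> interior A.core" for y
    using hol_lim_deriv[OF subsetD[OF interior_subset that]] at_within_interior[OF that] by simp
  have endpoint_derivs:
    "(hol_lim has_real_derivative hol'_lim (lim A.low)) (at_right (lim A.low))"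
    "(hol_lim has_real_derivative hol'_lim (lim A.high)) (at_left (lim A.high))"
    if "lim A.low < lim A.high"
    using hol_lim_deriv[OF lims_in_core(1)] hol_lim_deriv[OF lims_in_core(2)] that
    by (simp_all add: A.core_def at_within_Icc_at_right at_within_Icc_at_left)
  have diffeo: "orientation_preserving_diffeo_on A.core B.core hol_lim" if "\<theta> \<notin> pinch_points S M f"
    using that A.low_le_high_lim by (intro hol_lim_diffeo) (auto simp: pinch_points_def phi)
  show ?thesis
    unfolding K_n K_lim G_n G_lim phi
    by (intro conjI exI[of _ hol'_lim] allI ballI impI hol_image hol_uniform_limit hol_lim_image
        hol'_lim_continuous hol_differentiable derivs_converge interior_deriv endpoint_derivs diffeo)
qed

end
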